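(* Let $\Gamma$ be a finite abelian group with $|\Gamma|\ge 2$ and let $G$ be a connected Cayley graph on $\Gamma$. Let $\partial_2$ be the spectral gap (second smallest eigenvalue, counted with multiplicity) of the normalized distance Laplacian matrix of $G$. Then $\partial_2\ge \frac23$. Moreover, if $|\Gamma|$ is odd, then $\partial_2>0.718$.
   Context: For a group $\Gamma$ and a subset $S\subset\Gamma$ closed under taking inverses, the Cayley graph $\operatorname{Cay}(\Gamma,S)$ is the undirected graph with vertex set $\Gamma$ and edge set $\{(g,gs):g\in\Gamma,s\in S\}$. For a connected finite graph $G$ with shortest-path distance $d$, the transmission of a vertex $u$ is $t(u)=\sum_{v\in V(G)}d(u,v)$, the transmission matrix is the diagonal matrix $T=\operatorname{diag}(t(u):u\in V(G))$, and the distance matrix $\mathcal D$ has entries $\mathcal D_{u,v}=d(u,v)$. The normalized distance Laplacian is $\mathcal D^{\mathcal L}(G)=T^{-1/2}(T-\mathcal D)T^{-1/2}$, a real symmetric matrix, whose eigenvalues (with multiplicity) are denoted $0=\partial_1\le\partial_2\le\dots\le\partial_n$. *)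

theory Defs
  imports
    "Graph_Theory.Graph_Theory"
    "Jordan_Normal_Form.Char_Poly"
    "HOL-Computational_Algebra.Polynomial"
    "HOL-Library.Multiset"
begin

text \<open>
  Undirected graphs are symmetric digraphs, as in the library (locale \<^locale>\<open>pseudo_graph\<close>,
  which allows loops): the undirected edge between g and h is the pair of arcs (g, h) and (h, g).
  For inverse-closed S the arc set below is symmetric, see \<open>pseudo_graph_cayley_graph\<close>.
\<close>

definition cayley_graph :: "('a, 'm) monoid_scheme \<Rightarrow> 'a set \<Rightarrow> ('a, 'a \<times> 'a) pre_digraph" where
  "cayley_graph \<Gamma> S =
     \<lparr> verts = carrier \<Gamma>,
       arcs = {(g, g \<otimes>\<^bsub>\<Gamma>\<^esub> s) | g s. g \<in> carrier \<Gamma> \<and> s \<in> S},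
       tail = fst,
       head = snd \<rparr>"

text \<open>
  Shortest-path distance: the library's minimal walk cost with every arc of cost 1. The library
  value is an \<^typ>\<open>ereal\<close>, infinite exactly when there is no walk; the conversion to
  \<^typ>\<open>real\<close> is therefore only meaningful in connected graphs.
\<close>

definition graph_dist :: "('a, 'b) pre_digraph \<Rightarrow> 'a \<Rightarrow> 'a \<Rightarrow> real" where
  "graph_dist G u v = real_of_ereal (wf_digraph.\<mu> G (\<lambda>_. 1) u v)"

definition transmission :: "('a, 'b) pre_digraph \<Rightarrow> 'a \<Rightarrow> real" where
  "transmission G u = (\<Sum>v\<in>verts G. graph_dist G u v)"

text \<open>
  The matrices are indexed by \<open>{0..<n}\<close> through a list \<open>vs\<close> enumerating the \<open>n\<close> vertices without
  repetition.
\<close>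

definition distance_matrix :: "('a, 'b) pre_digraph \<Rightarrow> 'a list \<Rightarrow> real mat" where
  "distance_matrix G vs =
     mat (length vs) (length vs) (\<lambda>(i, j). graph_dist G (vs ! i) (vs ! j))"

definition transmission_matrix :: "('a, 'b) pre_digraph \<Rightarrow> 'a list \<Rightarrow> real mat" where
  "transmission_matrix G vs = mat_diag (length vs) (\<lambda>i. transmission G (vs ! i))"

definition transmission_matrix_inv_sqrt :: "('a, 'b) pre_digraph \<Rightarrow> 'a list \<Rightarrow> real mat" where
  "transmission_matrix_inv_sqrt G vs =
     mat_diag (length vs) (\<lambda>i. transmission G (vs ! i) powr (- 1 / 2))"

definition normalized_distance_laplacian :: "('a, 'b) pre_digraph \<Rightarrow> 'a list \<Rightarrow> real mat" where
  "normalized_distance_laplacian G vs =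
     transmission_matrix_inv_sqrt G vs * (transmission_matrix G vs - distance_matrix G vs)
       * transmission_matrix_inv_sqrt G vs"

text \<open>
  The real eigenvalues in increasing order, each repeated according to its multiplicity as a root
  of the characteristic polynomial. For a real symmetric matrix these are all the eigenvalues and
  algebraic and geometric multiplicities agree. The list is indexed from 0, so the k-th smallest
  eigenvalue is at position \<open>k - 1\<close>.
\<close>

definition sorted_eigenvalues :: "real mat \<Rightarrow> real list" where
  "sorted_eigenvalues A = sorted_list_of_multiset (proots (char_poly A))"

definition spectral_gap :: "real mat \<Rightarrow> real" where
  "spectral_gap A = sorted_eigenvalues A ! 1"

lemma pseudo_graph_cayley_graph:
  fixes \<Gamma> (structure)
  assumes "group \<Gamma>" "finite (carrier \<Gamma>)" "S \<subseteq> carrier \<Gamma>"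
    and inv: "\<And>s. s \<in> S \<Longrightarrow> inv s \<in> S"
  shows "pseudo_graph (cayley_graph \<Gamma> S)"
proof -
  interpret group \<Gamma> by fact
  have fin: "finite S"
    using assms(2,3) finite_subset by blast
  have "{(g, g \<otimes> s) | g s. g \<in> carrier \<Gamma> \<and> s \<in> S}
          = (\<lambda>(g, s). (g, g \<otimes> s)) ` (carrier \<Gamma> \<times> S)"
    by auto
  hence farcs: "finite (arcs (cayley_graph \<Gamma> S))"
    using assms(2) fin by (simp add: cayley_graph_def)
  have "(g \<otimes> s, g) \<in> arcs (cayley_graph \<Gamma> S)" if "g \<in> carrier \<Gamma>" "s \<in> S" for g s
  proof -
    have s: "s \<in> carrier \<Gamma>"
      using that assms(3) by blast
    have "(g \<otimes> s) \<otimes> inv s = g"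
      using that s by (simp add: m_assoc)
    thus ?thesis
      using that s inv[OF that(2)]
      unfolding cayley_graph_def by simp (metis m_closed)
  qed
  hence "symmetric (cayley_graph \<Gamma> S)"
    by (auto simp: symmetric_def sym_def arcs_ends_def arc_to_ends_def cayley_graph_def
        intro!: image_eqI)
  thus ?thesis
    using assms(2,3) farcs
    by unfold_locales (auto simp: cayley_graph_def)
qed

end

theory Submission
  imports
    Defs
    "HOL-Algebra.Multiplicative_Group"
    "HOL-Computational_Algebra.Fundamental_Theorem_Algebra"
begin

text \<open>
  Let \<open>l\<close> be the word length and \<open>t\<close> its sum over the group. The eigenspaces of the distance matrix
  are invariant under the commuting translations, so an eigenvector orthogonal to the constants can
  be replaced by a nontrivial character \<open>\<chi>\<close>, and the distance eigenvalue is
  \<open>\<lambda> = \<Sum>\<^sub>g l(g) \<chi>(g)\<close>, a real number. The corresponding eigenvalue of the normalized distance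
  Laplacian is \<open>1 - \<lambda> / t\<close>.

  The only property of \<open>l\<close> that bounds \<open>\<lambda>\<close> is the triangle inequality, summed against a weight:
  \<open>\<Sum>\<^sub>g \<Sum>\<^sub>h (l(g) + l(h) - l(gh)) w(g, h) \<ge> 0\<close> for \<open>w \<ge> 0\<close>.
  If \<open>\<chi>\<^sup>2\<close> is trivial, the weight \<open>(1 - \<chi>(g)) (1 - \<chi>(h))\<close> yields \<open>3 \<lambda> \<le> t\<close>.
  Otherwise the weight \<open>(1 - Re \<chi>(g) - Re \<chi>(h) + \<surd>2 Re \<chi>(gh))\<^sup>2\<close> and the orthogonality
  relations for \<open>\<chi>\<close> and \<open>\<chi>\<^sup>2\<close> yield \<open>(5 + 4 \<surd>2) \<lambda> \<le> 3 t\<close>, and \<open>1 - 3 / (5 + 4 \<surd>2) > 0.718\<close>.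
  In a group of odd order only the second case occurs.
\<close>

section \<open>Word lengths against characters\<close>

lemma (in group) sum_mult_left:
  assumes "g \<in> carrier G"
  shows "(\<Sum>h\<in>carrier G. f (g \<otimes> h)) = (\<Sum>h\<in>carrier G. f h)"
  by (rule sum.reindex_bij_witness[of _ "\<lambda>h. inv g \<otimes> h" "\<lambda>h. g \<otimes> h"])
     (use assms in \<open>auto simp: m_assoc[symmetric]\<close>)

lemma (in group) sum_inv:
  "(\<Sum>h\<in>carrier G. f (inv h)) = (\<Sum>h\<in>carrier G. f h)"
  by (rule sum.reindex_bij_witness[of _ "\<lambda>h. inv h" "\<lambda>h. inv h"]) auto

text \<open>Nontriviality of the character is encoded as \<open>sum_char\<close>, the form in which
  it is used; \<open>char_one\<close> excludes the zero function.\<close>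

locale finite_abelian_character = comm_group G for G (structure) +
  fixes \<chi> :: "'a \<Rightarrow> complex"
  assumes finite_carrier: "finite (carrier G)"
    and char_mult: "\<And>g h. g \<in> carrier G \<Longrightarrow> h \<in> carrier G \<Longrightarrow> \<chi> (g \<otimes> h) = \<chi> g * \<chi> h"
    and char_one: "\<chi> \<one> = 1"
    and sum_char: "(\<Sum>g\<in>carrier G. \<chi> g) = 0"
begin

section \<open>Values and orthogonality relations of a nontrivial character\<close>

lemma char_pow: "g \<in> carrier G \<Longrightarrow> \<chi> (g [^] (k::nat)) = \<chi> g ^ k"
  by (induction k) (auto simp: char_one char_mult)

lemma card_carrier_pos: "card (carrier G) > 0"
  using finite_carrier by (auto simp: card_gt_0_iff)

lemma char_pow_card: "g \<in> carrier G \<Longrightarrow> \<chi> g ^ card (carrier G) = 1"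
  using char_pow[of g "card (carrier G)"] pow_order_eq_1[of g]
  by (simp add: char_one Coset.order_def)

lemma norm_char: "g \<in> carrier G \<Longrightarrow> norm (\<chi> g) = 1"
  using char_pow_card[of g] card_carrier_pos
  by (metis norm_ge_zero norm_one norm_power power_eq_1_iff less_irrefl_nat)

lemma char_nonzero: "g \<in> carrier G \<Longrightarrow> \<chi> g \<noteq> 0"
  using norm_char by fastforce

lemma Re_Im_char: "g \<in> carrier G \<Longrightarrow> (Re (\<chi> g))\<^sup>2 + (Im (\<chi> g))\<^sup>2 = 1"
  using norm_char[of g] cmod_power2[of "\<chi> g"] by simp

lemma char_inv: 
  assumes g: "g \<in> carrier G"
  shows "\<chi> (inv g) = cnj (\<chi> g)"
proof -
  have "\<chi> (inv g) * \<chi> g = 1"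
    using char_mult[of "inv g" g] g by (simp add: char_one)
  moreover have "cnj (\<chi> g) * \<chi> g = 1"
    using Re_Im_char[OF g] by (simp add: complex_eq_iff power2_eq_square algebra_simps)
  ultimately show ?thesis
    using char_nonzero[OF g] by (metis mult_right_cancel)
qed

text \<open>Translating the sum by \<open>g\<close> multiplies it by
  \<open>(\<chi> g)\<^sup>2\<close>, so a nonzero sum forces all these factors to be 1.\<close>

lemma sum_char_sq_cases:
  "(\<Sum>g\<in>carrier G. (\<chi> g)\<^sup>2) = 0 \<or> (\<forall>g\<in>carrier G. (\<chi> g)\<^sup>2 = 1)"
proof -
  have "(\<chi> g)\<^sup>2 * (\<Sum>h\<in>carrier G. (\<chi> h)\<^sup>2) = (\<Sum>h\<in>carrier G. (\<chi> h)\<^sup>2)"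
    if g: "g \<in> carrier G" for g
    using sum_mult_left[OF g, of "\<lambda>h. (\<chi> h)\<^sup>2"]
    by (simp add: sum_distrib_left char_mult g power_mult_distrib)
  thus ?thesis by (metis mult_cancel_right1)
qed

text \<open>If all squares were 1, the odd power \<open>\<chi> g ^ card (carrier G) = 1\<close>
  would leave \<open>\<chi> g = 1\<close>, and \<open>\<chi>\<close> would not sum to 0.\<close>

lemma sum_char_sq_odd:
  assumes "odd (card (carrier G))"
  shows "(\<Sum>g\<in>carrier G. (\<chi> g)\<^sup>2) = 0"
proof (rule ccontr)
  assume "\<not> ?thesis"
  hence sq: "\<forall>g\<in>carrier G. (\<chi> g)\<^sup>2 = 1"
    using sum_char_sq_cases by blast
  have "\<chi> g = 1" if g: "g \<in> carrier G" for g
  proof -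
    from assms obtain k where "card (carrier G) = 2 * k + 1" by (elim oddE)
    with char_pow_card[OF g] sq g show ?thesis
      by (simp add: power_mult)
  qed
  with sum_char card_carrier_pos show False by simp
qed

section \<open>The triangle inequality summed against weights\<close>

text \<open>Collects the coefficient of \<open>l g\<close>. By symmetry of \<open>w\<close> the
  terms with \<open>l g\<close> and \<open>l h\<close> contribute equally; the third term becomes a
  sum over the factorisations \<open>g = h \<otimes> (inv h \<otimes> g)\<close>.\<close>

lemma weighted_triangle:
  fixes l :: "'a \<Rightarrow> real" and w :: "'a \<Rightarrow> 'a \<Rightarrow> real"
  assumes sub: "\<And>g h. g \<in> carrier G \<Longrightarrow> h \<in> carrier G \<Longrightarrow> l (g \<otimes> h) \<le> l g + l h"
    and w: "\<And>g h. g \<in> carrier G \<Longrightarrow> h \<in> carrier G \<Longrightarrow> w g h \<ge> 0"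
    and sym: "\<And>g h. g \<in> carrier G \<Longrightarrow> h \<in> carrier G \<Longrightarrow> w g h = w h g"
  shows "0 \<le> (\<Sum>g\<in>carrier G. l g * (2 * (\<Sum>h\<in>carrier G. w g h) - (\<Sum>h\<in>carrier G. w h (inv h \<otimes> g))))"
proof -
  let ?C = "carrier G"
  have "0 \<le> (\<Sum>g\<in>?C. \<Sum>h\<in>?C. (l g + l h - l (g \<otimes> h)) * w g h)"
    by (intro sum_nonneg mult_nonneg_nonneg) (auto simp: sub w)
  also have "\<dots> = (\<Sum>g\<in>?C. \<Sum>h\<in>?C. l g * w g h) + (\<Sum>g\<in>?C. \<Sum>h\<in>?C. l h * w g h)
      - (\<Sum>g\<in>?C. \<Sum>h\<in>?C. l (g \<otimes> h) * w g h)"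
    by (simp add: algebra_simps sum.distrib sum_subtractf)
  also have "(\<Sum>g\<in>?C. \<Sum>h\<in>?C. l h * w g h) = (\<Sum>g\<in>?C. \<Sum>h\<in>?C. l g * w g h)"
    by (subst sum.swap) (auto intro!: sum.cong simp: sym)
  also have "(\<Sum>g\<in>?C. \<Sum>h\<in>?C. l (g \<otimes> h) * w g h) = (\<Sum>g\<in>?C. \<Sum>k\<in>?C. l k * w g (inv g \<otimes> k))"
  proof (rule sum.cong[OF refl])
    fix g assume g: "g \<in> ?C"
    show "(\<Sum>h\<in>?C. l (g \<otimes> h) * w g h) = (\<Sum>k\<in>?C. l k * w g (inv g \<otimes> k))"
      using sum_mult_left[OF g, of "\<lambda>k. l k * w g (inv g \<otimes> k)"] g
      by (simp add: m_assoc[symmetric] cong: sum.cong)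
  qed
  also have "\<dots> = (\<Sum>k\<in>?C. \<Sum>g\<in>?C. l k * w g (inv g \<otimes> k))"
    by (rule sum.swap)
  finally show ?thesis
    by (simp add: sum_distrib_left algebra_simps sum.distrib sum_subtractf)
qed

text \<open>Here \<open>\<chi>\<close> only takes the values 1 and -1. The weight is 4 on pairs
  outside its kernel and 0 elsewhere, and the coefficient of \<open>l g\<close> becomes a positive
  multiple of \<open>1 - 3 * Re (\<chi> g)\<close>.\<close>

lemma length_char_bound_real:
  fixes l :: "'a \<Rightarrow> real"
  assumes sub: "\<And>g h. g \<in> carrier G \<Longrightarrow> h \<in> carrier G \<Longrightarrow> l (g \<otimes> h) \<le> l g + l h"
    and sq: "\<forall>g\<in>carrier G. (\<chi> g)\<^sup>2 = 1"
  shows "3 * (\<Sum>g\<in>carrier G. l g * Re (\<chi> g)) \<le> (\<Sum>g\<in>carrier G. l g)"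
proof -
  let ?C = "carrier G" and ?n = "real (card (carrier G))"
  have Im0: "Im (\<chi> g) = 0" and Re1: "(Re (\<chi> g))\<^sup>2 = 1" if "g \<in> ?C" for g
    using sq that by (auto simp: power2_eq_1_iff)
  have s0: "(\<Sum>h\<in>?C. Re (\<chi> h)) = 0"
    using arg_cong[OF sum_char, of Re] by simp
  define w where "w g h = (1 - Re (\<chi> g)) * (1 - Re (\<chi> h))" for g h
  have nonneg: "w g h \<ge> 0" if "g \<in> ?C" "h \<in> ?C" for g h
    unfolding w_def using that norm_char complex_Re_le_cmod[of "\<chi> g"] complex_Re_le_cmod[of "\<chi> h"]
    by (intro mult_nonneg_nonneg) auto
  have sym: "w g h = w h g" for g h
    by (simp add: w_def)
  have A: "(\<Sum>h\<in>?C. w g h) = ?n * (1 - Re (\<chi> g))" for g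
    by (simp add: w_def sum_distrib_left[symmetric] sum_subtractf s0)
  have B: "(\<Sum>h\<in>?C. w h (inv h \<otimes> g)) = ?n * (1 + Re (\<chi> g))" if g: "g \<in> ?C" for g
  proof -
    have "w h (inv h \<otimes> g) = (1 + Re (\<chi> g)) - (1 + Re (\<chi> g)) * Re (\<chi> h)" if h: "h \<in> ?C" for h
    proof -
      have "Re (\<chi> (inv h \<otimes> g)) = Re (\<chi> h) * Re (\<chi> g)"
        using g h by (simp add: char_mult char_inv Im0)
      hence "w h (inv h \<otimes> g) = 1 - Re (\<chi> h) - Re (\<chi> h) * Re (\<chi> g) + (Re (\<chi> h))\<^sup>2 * Re (\<chi> g)"
        by (simp add: w_def algebra_simps power2_eq_square)
      thus ?thesis using Re1[OF h] by (simp add: algebra_simps)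
    qed
    thus ?thesis
      by (simp add: sum_subtractf sum_distrib_left[symmetric] s0)
  qed
  have "0 \<le> (\<Sum>g\<in>?C. l g * (2 * (?n * (1 - Re (\<chi> g))) - ?n * (1 + Re (\<chi> g))))"
    using weighted_triangle[of l w, OF sub nonneg sym] by (simp add: A B cong: sum.cong)
  also have "\<dots> = (\<Sum>g\<in>?C. ?n * (l g - 3 * (l g * Re (\<chi> g))))"
    by (simp add: algebra_simps)
  also have "\<dots> = ?n * ((\<Sum>g\<in>?C. l g) - 3 * (\<Sum>g\<in>?C. l g * Re (\<chi> g)))"
    by (simp only: sum_distrib_left[symmetric] sum_subtractf)
  finally show ?thesis
    using card_carrier_pos by (simp add: zero_le_mult_iff)
qed

text \<open>Parseval for 1, \<open>Re \<chi>\<close> and \<open>Im \<chi>\<close>: the vanishing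
  sums of \<open>\<chi>\<close> and \<open>\<chi>\<^sup>2\<close> make them orthogonal with mean
  squares 1, 1/2 and 1/2.\<close>

lemma sum_square_affine:
  fixes u v w :: real
  assumes sq: "(\<Sum>g\<in>carrier G. (\<chi> g)\<^sup>2) = 0"
  shows "(\<Sum>h\<in>carrier G. (u + v * Re (\<chi> h) + w * Im (\<chi> h))\<^sup>2)
     = real (card (carrier G)) * (u\<^sup>2 + v\<^sup>2 / 2 + w\<^sup>2 / 2)"
proof -
  let ?C = "carrier G" and ?n = "real (card (carrier G))"
  have p: "(\<Sum>h\<in>?C. Re (\<chi> h)) = 0" and q: "(\<Sum>h\<in>?C. Im (\<chi> h)) = 0"
    using arg_cong[OF sum_char, of Re] arg_cong[OF sum_char, of Im] by simp_all
  have diff: "(\<Sum>h\<in>?C. (Re (\<chi> h))\<^sup>2) - (\<Sum>h\<in>?C. (Im (\<chi> h))\<^sup>2) = 0"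
    using arg_cong[OF sq, of Re] by (simp add: sum_subtractf Re_power2)
  have "(\<Sum>h\<in>?C. (Re (\<chi> h))\<^sup>2) + (\<Sum>h\<in>?C. (Im (\<chi> h))\<^sup>2) = ?n"
    by (simp add: sum.distrib[symmetric] Re_Im_char)
  with diff have pp: "(\<Sum>h\<in>?C. (Re (\<chi> h))\<^sup>2) = ?n / 2" and qq: "(\<Sum>h\<in>?C. (Im (\<chi> h))\<^sup>2) = ?n / 2"
    by simp_all
  have pq: "(\<Sum>h\<in>?C. Re (\<chi> h) * Im (\<chi> h)) = 0"
    using arg_cong[OF sq, of Im] by (simp add: Im_power2 mult.assoc sum_distrib_left[symmetric])
  have "(\<Sum>h\<in>?C. (u + v * Re (\<chi> h) + w * Im (\<chi> h))\<^sup>2)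
    = (\<Sum>h\<in>?C. u\<^sup>2 + v\<^sup>2 * (Re (\<chi> h))\<^sup>2 + w\<^sup>2 * (Im (\<chi> h))\<^sup>2 + (2 * u * v) * Re (\<chi> h)
        + (2 * u * w) * Im (\<chi> h) + (2 * v * w) * (Re (\<chi> h) * Im (\<chi> h)))"
    by (intro sum.cong refl) (simp add: power2_eq_square algebra_simps)
  also have "\<dots> = ?n * u\<^sup>2 + v\<^sup>2 * (?n / 2) + w\<^sup>2 * (?n / 2)"
    by (simp only: sum.distrib sum_distrib_left[symmetric] p q pp qq pq) simp
  finally show ?thesis by (simp add: algebra_simps)
qed

text \<open>For fixed \<open>g\<close>, the weights \<open>w g h\<close> and
  \<open>w h (inv h \<otimes> g)\<close> are squares of affine functions of
  \<open>Re (\<chi> h)\<close> and \<open>Im (\<chi> h)\<close>, so \<open>sum_square_affine\<close>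
  evaluates the coefficient of \<open>l g\<close> exactly.\<close>

lemma length_char_bound:
  fixes l :: "'a \<Rightarrow> real"
  assumes sub: "\<And>g h. g \<in> carrier G \<Longrightarrow> h \<in> carrier G \<Longrightarrow> l (g \<otimes> h) \<le> l g + l h"
    and sq: "(\<Sum>g\<in>carrier G. (\<chi> g)\<^sup>2) = 0"
  shows "(5 + 4 * sqrt 2) * (\<Sum>g\<in>carrier G. l g * Re (\<chi> g)) \<le> 3 * (\<Sum>g\<in>carrier G. l g)"
proof -
  let ?C = "carrier G" and ?n = "real (card (carrier G))"
  \<comment> \<open>Ansatz \<open>(1 - r (Re (\<chi> g) + Re (\<chi> h)) + s Re (\<chi> (g h)))\<^sup>2\<close>; the quadratic terms of \<open>key\<close> cancel
    exactly when \<open>s\<^sup>2 = 2 r\<^sup>2\<close>, and \<open>r = 1\<close> is close to optimal.\<close>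
  \<comment> \<open>Ansatz \<open>(1 - r (Re (\<chi> g) + Re (\<chi> h)) + s Re (\<chi> (g h)))\<^sup>2\<close>; the quadratic terms of \<open>key\<close> cancel
    exactly when \<open>s\<^sup>2 = 2 r\<^sup>2\<close>, and \<open>r = 1\<close> is close to optimal.\<close>
  define w where "w g h = (1 - Re (\<chi> g) - Re (\<chi> h) + sqrt 2 * Re (\<chi> (g \<otimes> h)))\<^sup>2" for g h
  have sym: "w g h = w h g" if "g \<in> ?C" "h \<in> ?C" for g h
    using that by (simp add: w_def m_comm algebra_simps)
  have nonneg: "w g h \<ge> 0" for g h
    by (simp add: w_def)
  have key: "2 * (\<Sum>h\<in>?C. w g h) - (\<Sum>h\<in>?C. w h (inv h \<otimes> g)) = ?n * (3 - (5 + 4 * sqrt 2) * Re (\<chi> g))"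
    if g: "g \<in> ?C" for g
  proof -
    define x y where "x = Re (\<chi> g)" and "y = Im (\<chi> g)"
    have xy: "y\<^sup>2 = 1 - x\<^sup>2"
      using Re_Im_char[OF g] by (simp add: x_def y_def)
    have "w g h = ((1 - x) + (sqrt 2 * x - 1) * Re (\<chi> h) + (- sqrt 2 * y) * Im (\<chi> h))\<^sup>2"
      if "h \<in> ?C" for h
      unfolding w_def by (rule arg_cong[where f = "\<lambda>t. t\<^sup>2"]) (simp add: char_mult g that x_def y_def algebra_simps)
    hence A: "(\<Sum>h\<in>?C. w g h) = ?n * ((1 - x)\<^sup>2 + (sqrt 2 * x - 1)\<^sup>2 / 2 + (- sqrt 2 * y)\<^sup>2 / 2)"
      by (simp only: sum_square_affine[OF sq] cong: sum.cong)
    have "w h (inv h \<otimes> g) = ((1 + sqrt 2 * x) + (- 1 - x) * Re (\<chi> h) + (- y) * Im (\<chi> h))\<^sup>2"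
      if h: "h \<in> ?C" for h
    proof -
      have "h \<otimes> (inv h \<otimes> g) = g"
        using g h by (simp add: m_assoc[symmetric])
      thus ?thesis unfolding w_def
        by (intro arg_cong[where f = "\<lambda>t. t\<^sup>2"]) (simp add: char_mult char_inv g h x_def y_def algebra_simps)
    qed
    hence B: "(\<Sum>h\<in>?C. w h (inv h \<otimes> g)) = ?n * ((1 + sqrt 2 * x)\<^sup>2 + (- 1 - x)\<^sup>2 / 2 + (- y)\<^sup>2 / 2)"
      by (simp only: sum_square_affine[OF sq] cong: sum.cong)
    \<comment> \<open>Both \<open>x\<^sup>2\<close> and \<open>y\<^sup>2\<close> occur with
      coefficient 3/2, so \<open>xy\<close> turns them into a constant and only the linear term in
      \<open>x\<close> survives.\<close>
    have e: "2 * ((1 - x)\<^sup>2 + (sqrt 2 * x - 1)\<^sup>2 / 2 + (- sqrt 2 * y)\<^sup>2 / 2)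
        - ((1 + sqrt 2 * x)\<^sup>2 + (- 1 - x)\<^sup>2 / 2 + (- y)\<^sup>2 / 2) = 3 - (5 + 4 * sqrt 2) * x"
      by (simp add: power_mult_distrib xy power2_diff power2_sum algebra_simps)
         (simp add: field_simps power2_eq_square)?
    have "2 * (?n * X) - ?n * Y = ?n * (2 * X - Y)" for X Y :: real
      by (simp add: algebra_simps)
    thus ?thesis unfolding A B by (simp only: e) (simp add: x_def)
  qed
  have "0 \<le> (\<Sum>g\<in>?C. l g * (?n * (3 - (5 + 4 * sqrt 2) * Re (\<chi> g))))"
    using weighted_triangle[of l w, OF sub nonneg sym] by (simp add: key cong: sum.cong)
  also have "\<dots> = (\<Sum>g\<in>?C. ?n * (3 * l g - (5 + 4 * sqrt 2) * (l g * Re (\<chi> g))))"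
    by (simp add: algebra_simps)
  also have "\<dots> = ?n * (3 * (\<Sum>g\<in>?C. l g) - (5 + 4 * sqrt 2) * (\<Sum>g\<in>?C. l g * Re (\<chi> g)))"
    by (simp only: sum_distrib_left[symmetric] sum_subtractf)
  finally show ?thesis
    using card_carrier_pos by (simp add: zero_le_mult_iff)
qed

end

section \<open>Characters from eigenfunctions\<close>

text \<open>For \<open>j > 0\<close> this is a geometric sum over an n-th root of unity other than
  1. It serves to recover a function from its averages along the powers of a translation.\<close>

lemma sum_cis_multiples:
  assumes "j < n"
  shows "(\<Sum>k<n. cis (2 * pi / n) ^ (k * j)) = (if j = 0 then of_nat n else 0)"
proof (cases "j = 0")
  case False
  define z where "z = cis (2 * pi / n) ^ j"
  have z: "z = cis (2 * pi * real j / real n)"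
    by (simp add: z_def DeMoivre mult_ac)
  have "z \<noteq> 1"
  proof
    assume "z = 1"
    hence "cis (2 * pi * real j / real n) = cis (2 * pi * real 0 / real n)"
      by (simp add: z)
    hence "j = 0"
      using inj_onD[OF bij_betw_imp_inj_on[OF bij_betw_roots_unity[of n]], of j 0] assms by simp
    with False show False by simp
  qed
  moreover have "z ^ n = 1"
    using assms by (simp add: z DeMoivre)
  ultimately have "(\<Sum>k<n. z ^ k) = 0"
    by (simp add: sum_gp_strict)
  thus ?thesis
    using False by (simp add: z_def power_mult[symmetric] mult.commute)
qed simp

text \<open>
  A translation has finite order, so averaging a function along its powers against the roots of
  unity decomposes the function into eigenfunctions of this translation.
\<close>

lemma (in comm_group) common_eigenfunction:
  fixes f :: "'a \<Rightarrow> complex"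
  assumes fin: "finite (carrier G)"
    and trans: "\<And>f c. f \<in> V \<Longrightarrow> c \<in> carrier G \<Longrightarrow> (\<lambda>g. f (c \<otimes> g)) \<in> V"
    and zero: "(\<lambda>_. 0) \<in> V"
    and add: "\<And>f h. f \<in> V \<Longrightarrow> h \<in> V \<Longrightarrow> (\<lambda>g. f g + h g) \<in> V"
    and scale: "\<And>f z. f \<in> V \<Longrightarrow> (\<lambda>g. z * f g) \<in> V"
    and f: "f \<in> V" "\<exists>g\<in>carrier G. f g \<noteq> 0"
  obtains h where "h \<in> V" "\<exists>g\<in>carrier G. h g \<noteq> 0"
    "\<And>c. c \<in> carrier G \<Longrightarrow> \<exists>z. \<forall>g\<in>carrier G. h (c \<otimes> g) = z * h g"
proof -
  define N where "N = card (carrier G)"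
  define \<zeta> where "\<zeta> = cis (2 * pi / N)"
  have \<zeta>N: "\<zeta> ^ N = 1"
    using fin by (auto simp: \<zeta>_def DeMoivre N_def card_eq_0_iff)
  \<comment> \<open>Induction on the set \<open>T\<close> of translations already
    diagonalised.\<close>
  have "\<exists>h\<in>V. (\<exists>g\<in>carrier G. h g \<noteq> 0) \<and> (\<forall>c\<in>T. \<exists>z. \<forall>g\<in>carrier G. h (c \<otimes> g) = z * h g)"
    if "finite T" "T \<subseteq> carrier G" for T
    using that
  proof (induction T)
    case empty
    show ?case using f by blast
  next
    case (insert c T)
    have c: "c \<in> carrier G" using insert by simp
    obtain h where h: "h \<in> V" "\<exists>g\<in>carrier G. h g \<noteq> 0"
      and eig: "\<And>d. d \<in> T \<Longrightarrow> \<exists>z. \<forall>g\<in>carrier G. h (d \<otimes> g) = z * h g"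
      using insert by auto
    \<comment> \<open>Up to the factor \<open>N\<close>, \<open>H k\<close> is the projection of
      \<open>h\<close> to the eigenspace of translation by \<open>c\<close> for the eigenvalue
      \<open>inverse (\<zeta> ^ k)\<close>.\<close>
    define H where "H k g = (\<Sum>j<N. \<zeta> ^ (k * j) * h (c [^] j \<otimes> g))" for k g
    have "(\<lambda>g. \<Sum>j\<in>J. \<zeta> ^ (k * j) * h (c [^] j \<otimes> g)) \<in> V" if "finite J" for J :: "nat set" and k
      using that
    proof (induction J)
      case (insert j J)
      have "(\<lambda>g. \<zeta> ^ (k * j) * h (c [^] j \<otimes> g) + (\<Sum>j\<in>J. \<zeta> ^ (k * j) * h (c [^] j \<otimes> g))) \<in> V"
        using trans[OF h(1), of "c [^] j"] c by (intro add scale insert.IH) auto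
      thus ?case using insert.hyps by simp
    qed (simp add: zero)
    hence HV: "H k \<in> V" for k
      unfolding H_def by blast
    \<comment> \<open>On the carrier, the \<open>H k\<close> with \<open>k < N\<close> add up to
      \<open>N\<close> times \<open>h\<close>, so they cannot all vanish.\<close>
    have "\<exists>k. \<exists>g\<in>carrier G. H k g \<noteq> 0"
    proof (rule ccontr)
      assume "\<not> ?thesis"
      hence H0: "H k g = 0" if "g \<in> carrier G" for k g using that by blast
      from h(2) obtain g where g: "g \<in> carrier G" "h g \<noteq> 0" by blast
      have N: "N > 0" using fin by (auto simp: N_def card_gt_0_iff)
      have "0 = (\<Sum>k<N. H k g)"
        using g H0 by simp
      also have "\<dots> = (\<Sum>j<N. (\<Sum>k<N. \<zeta> ^ (k * j)) * h (c [^] j \<otimes> g))"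
        unfolding H_def by (subst sum.swap) (simp add: sum_distrib_right)
      also have "\<dots> = (\<Sum>j<N. if j = 0 then of_nat N * h (c [^] j \<otimes> g) else 0)"
        unfolding \<zeta>_def by (intro sum.cong refl) (simp add: sum_cis_multiples)
      also have "\<dots> = of_nat N * h g"
        using N g by simp
      finally show False using N g by simp
    qed
    then obtain k where k: "\<exists>g\<in>carrier G. H k g \<noteq> 0" by blast
    have "\<exists>z. \<forall>g\<in>carrier G. H k (d \<otimes> g) = z * H k g" if d: "d \<in> insert c T" for d
    proof (cases "d \<in> T")
      case True
      with eig obtain z where z: "\<And>g. g \<in> carrier G \<Longrightarrow> h (d \<otimes> g) = z * h g" by blast
      have dG: "d \<in> carrier G" using d insert.prems by blast
      have "H k (d \<otimes> g) = z * H k g" if g: "g \<in> carrier G" for g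
      proof -
        \<comment> \<open>Translations commute, so averaging along \<open>c\<close> preserves the
          eigenvalue equations for \<open>T\<close>.\<close>
        have "h (c [^] j \<otimes> (d \<otimes> g)) = z * h (c [^] j \<otimes> g)" for j :: nat
          using z[of "c [^] j \<otimes> g"] c dG g by (simp add: m_lcomm)
        thus ?thesis
          unfolding H_def by (simp add: sum_distrib_left algebra_simps)
      qed
      thus ?thesis by blast
    next
      case False
      hence d: "d = c" using that by simp
      \<comment> \<open>The left side shifts \<open>j\<close> by one, which only permutes the
        summands cyclically because \<open>c [^] N = \<one>\<close> and
        \<open>\<zeta> ^ N = 1\<close>.\<close>
      have "\<zeta> ^ k * H k (c \<otimes> g) = H k g" if g: "g \<in> carrier G" for g
      proof -
        define F where "F j = \<zeta> ^ (k * j) * h (c [^] j \<otimes> g)" for j :: nat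
        have "F N = F 0"
          using c g pow_order_eq_1[OF c] \<zeta>N unfolding F_def
          by (simp add: N_def Coset.order_def power_mult mult.commute[of k])
        have "\<zeta> ^ k * H k (c \<otimes> g) = (\<Sum>j<N. F (Suc j))"
          unfolding H_def F_def using c g
          by (simp add: sum_distrib_left power_add m_assoc mult_ac)
        also have "\<dots> + F 0 = (\<Sum>j<N. F j) + F N"
          using sum.lessThan_Suc_shift[of F N] by simp
        finally show ?thesis
          using \<open>F N = F 0\<close> by (simp add: H_def F_def)
      qed
      hence "H k (c \<otimes> g) = inverse (\<zeta> ^ k) * H k g" if "g \<in> carrier G" for g
        using that by (simp add: \<zeta>_def field_simps)
      thus ?thesis using d by blast
    qed
    thus ?case using HV k by blast
  qed
  from this[OF fin order_refl] that show ?thesis by blast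
qed

text \<open>The sum-zero eigenfunctions for \<open>x\<close> form a translation-invariant space,
  which therefore contains a common eigenfunction \<open>h\<close> of all translations. Divided by
  its value at the identity, \<open>h\<close> is multiplicative; the eigenvalue equation at the
  identity then gives \<open>x\<close>.\<close>

lemma (in comm_group) convolution_eigenvalue_character:
  fixes f :: "'a \<Rightarrow> complex" and l :: "'a \<Rightarrow> complex"
  assumes fin: "finite (carrier G)"
    and f: "\<exists>g\<in>carrier G. f g \<noteq> 0" "(\<Sum>g\<in>carrier G. f g) = 0"
    and eig: "\<And>g. g \<in> carrier G \<Longrightarrow> (\<Sum>k\<in>carrier G. l k * f (g \<otimes> k)) = x * f g"
  obtains \<chi> where "finite_abelian_character G \<chi>" "x = (\<Sum>k\<in>carrier G. l k * \<chi> k)"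
proof -
  define V where "V = {f :: 'a \<Rightarrow> complex. (\<Sum>g\<in>carrier G. f g) = 0 \<and>
    (\<forall>g\<in>carrier G. (\<Sum>k\<in>carrier G. l k * f (g \<otimes> k)) = x * f g)}"
  obtain h where h: "h \<in> V" "\<exists>g\<in>carrier G. h g \<noteq> 0"
    and ch: "\<And>c. c \<in> carrier G \<Longrightarrow> \<exists>z. \<forall>g\<in>carrier G. h (c \<otimes> g) = z * h g"
  proof (rule common_eigenfunction[OF fin, of V f])
    fix f c assume "f \<in> V" and c: "c \<in> carrier G"
    thus "(\<lambda>g. f (c \<otimes> g)) \<in> V"
      by (auto simp: V_def sum_mult_left m_assoc[symmetric])
  next
    fix f h assume "f \<in> V" "h \<in> V"
    thus "(\<lambda>g. f g + h g) \<in> V"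
      by (simp add: V_def algebra_simps sum.distrib)
  next
    fix f z assume "f \<in> V"
    thus "(\<lambda>g. z * f g) \<in> V"
      by (simp add: V_def mult.left_commute[of _ z] flip: sum_distrib_left)
  qed (use f eig in \<open>auto simp: V_def\<close>)
  have hmult: "h (c \<otimes> g) * h \<one> = h c * h g" if c: "c \<in> carrier G" and g: "g \<in> carrier G" for c g
  proof -
    obtain z where z: "\<And>g. g \<in> carrier G \<Longrightarrow> h (c \<otimes> g) = z * h g"
      using ch[OF c] by blast
    from z[of \<one>] z[of g] c g show ?thesis by simp
  qed
  \<comment> \<open>Otherwise \<open>hmult\<close> would make all products \<open>h c * h g\<close>
    vanish, including the square of a nonzero value.\<close>
  have h1: "h \<one> \<noteq> 0"
    using h(2) hmult by (metis inv_closed mult_zero_right no_zero_divisors r_inv)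
  define \<chi> where "\<chi> g = h g / h \<one>" for g
  have "finite_abelian_character G \<chi>"
  proof unfold_locales
    show "\<chi> (g \<otimes> k) = \<chi> g * \<chi> k" if "g \<in> carrier G" "k \<in> carrier G" for g k
      using hmult[OF that] h1 by (simp add: \<chi>_def field_simps)
    show "(\<Sum>g\<in>carrier G. \<chi> g) = 0"
      using h(1) by (simp add: \<chi>_def V_def flip: sum_divide_distrib)
  qed (use fin h1 in \<open>auto simp: \<chi>_def\<close>)
  moreover have "x = (\<Sum>k\<in>carrier G. l k * \<chi> k)"
  proof -
    have "(\<Sum>k\<in>carrier G. l k * h (\<one> \<otimes> k)) = x * h \<one>"
      using h(1) unfolding V_def by blast
    thus ?thesis
      using h1 by (simp add: \<chi>_def field_simps flip: sum_divide_distrib cong: sum.cong)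
  qed
  ultimately show ?thesis by (rule that)
qed

section \<open>Distances in Cayley graphs\<close>

lemma (in wf_digraph) awalk_cost_unit: "awalk_cost (\<lambda>_. 1) p = length p"
  by (induction p) auto

lemma (in wf_digraph) graph_dist_le_length:
  assumes "awalk u p v"
  shows "graph_dist G u v \<le> length p"
proof -
  have "\<mu> (\<lambda>_. 1) u v \<le> ereal (length p)"
    using min_cost_le_walk_cost[OF assms, of "\<lambda>_. 1"] by (simp add: awalk_cost_unit)
  moreover have "\<mu> (\<lambda>_. 1) u v \<ge> 0"
    unfolding \<mu>_def by (intro INF_greatest) (simp add: awalk_cost_unit)
  ultimately show ?thesis
    unfolding graph_dist_def by (cases "\<mu> (\<lambda>_. 1) u v") auto
qed

text \<open>Walk lengths are natural numbers, so the infimum is attained once a walk exists; in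
  particular it is finite and survives the conversion to \<open>real\<close>.\<close>

lemma (in wf_digraph) graph_dist_walk:
  assumes "u \<rightarrow>\<^sup>* v"
  obtains p where "awalk u p v" "graph_dist G u v = length p"
proof -
  obtain p0 where "awalk u p0 v"
    using assms unfolding reachable_awalk by blast
  then obtain q where q: "awalk u q v" "\<And>r. awalk u r v \<Longrightarrow> length q \<le> length r"
    using arg_min_nat_lemma[of "\<lambda>p. awalk u p v" p0 length] by blast
  have "\<mu> (\<lambda>_. 1) u v = ereal (length q)"
    unfolding \<mu>_def by (intro INF_eqI) (use q in \<open>auto simp: awalk_cost_unit\<close>)
  with q(1) that show ?thesis by (simp add: graph_dist_def)
qed

lemma (in wf_digraph) graph_dist_nonneg: "graph_dist G u v \<ge> 0"
  unfolding graph_dist_def \<mu>_def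
  by (intro real_of_ereal_pos INF_greatest) (simp add: awalk_cost_unit)

lemma (in wf_digraph) graph_dist_triangle:
  assumes "u \<rightarrow>\<^sup>* v" "v \<rightarrow>\<^sup>* w"
  shows "graph_dist G u w \<le> graph_dist G u v + graph_dist G v w"
proof -
  obtain p where p: "awalk u p v" "graph_dist G u v = length p"
    using graph_dist_walk[OF assms(1)] .
  obtain q where q: "awalk v q w" "graph_dist G v w = length q"
    using graph_dist_walk[OF assms(2)] .
  have "awalk u (p @ q) w"
    using p q by (blast intro: awalk_appendI)
  from graph_dist_le_length[OF this] p q show ?thesis by simp
qed

lemma (in wf_digraph) graph_dist_pos:
  assumes "u \<rightarrow>\<^sup>* v" "u \<noteq> v"
  shows "graph_dist G u v > 0"
proof -
  obtain p where p: "awalk u p v" "graph_dist G u v = length p"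
    using graph_dist_walk[OF assms(1)] .
  with assms(2) have "p \<noteq> []" by (auto simp: awalk_Nil_iff)
  with p show ?thesis by simp
qed

text \<open>The pair \<open>f\<close>, \<open>F\<close> maps walks to walks of equal length. For
  translations and inversion the reverse inequality comes from the inverse map.\<close>

lemma (in wf_digraph) graph_dist_endomorphism:
  assumes "u \<rightarrow>\<^sup>* v"
    and verts: "\<And>x. x \<in> verts G \<Longrightarrow> f x \<in> verts G"
    and arcs: "\<And>e. e \<in> arcs G \<Longrightarrow> F e \<in> arcs G \<and> tail G (F e) = f (tail G e) \<and> head G (F e) = f (head G e)"
  shows "graph_dist G (f u) (f v) \<le> graph_dist G u v"
proof -
  obtain p where p: "awalk u p v" "graph_dist G u v = length p"
    using graph_dist_walk[OF assms(1)] .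
  from p(1) have "awalk (f u) (map F p) (f v)"
    by (induction p arbitrary: u) (auto simp: awalk_simps verts arcs)
  from graph_dist_le_length[OF this] p show ?thesis by simp
qed

section \<open>Word length in a connected Cayley graph of a finite abelian group\<close>

lemma verts_cayley_graph [simp]: "verts (cayley_graph G S) = carrier G"
  by (simp add: cayley_graph_def)

locale connected_cayley_graph = comm_group \<Gamma> for \<Gamma> :: "('a, 'm) monoid_scheme" (structure) +
  fixes S :: "'a set"
  assumes finite_group: "finite (carrier \<Gamma>)"
    and gens: "S \<subseteq> carrier \<Gamma>"
    and inv_gens: "\<And>s. s \<in> S \<Longrightarrow> inv s \<in> S"
    and connected: "connected (cayley_graph \<Gamma> S)"
begin

abbreviation "\<G> \<equiv> cayley_graph \<Gamma> S"

definition word_length :: "'a \<Rightarrow> real" where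
  "word_length g = graph_dist \<G> \<one> g"

sublocale cayley: pseudo_graph \<G>
  by (rule pseudo_graph_cayley_graph) (use finite_group gens inv_gens is_group in auto)

text \<open>Connectedness means strong connectedness of the symmetric closure, and the arcs are
  already symmetric.\<close>

lemma reachable: "u \<in> carrier \<Gamma> \<Longrightarrow> v \<in> carrier \<Gamma> \<Longrightarrow> u \<rightarrow>\<^sup>*\<^bsub>\<G>\<^esub> v"
  using connected cayley.reachable_mk_symmetric_eq[OF cayley.sym_arcs]
  unfolding connected_def strongly_connected_def by simp

lemma graph_dist_translate_le:
  assumes "u \<in> carrier \<Gamma>" "v \<in> carrier \<Gamma>" "g \<in> carrier \<Gamma>"
  shows "graph_dist \<G> (g \<otimes> u) (g \<otimes> v) \<le> graph_dist \<G> u v"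
proof (rule cayley.graph_dist_endomorphism[OF reachable, where f = "\<lambda>x. g \<otimes> x" and F = "\<lambda>(a, b). (g \<otimes> a, g \<otimes> b)"])
  fix e assume "e \<in> arcs \<G>"
  then obtain a s where e: "e = (a, a \<otimes> s)" "a \<in> carrier \<Gamma>" "s \<in> S"
    by (auto simp: cayley_graph_def)
  have "g \<otimes> (a \<otimes> s) = g \<otimes> a \<otimes> s"
    using e gens assms by (auto simp: m_assoc)
  thus "(case e of (a, b) \<Rightarrow> (g \<otimes> a, g \<otimes> b)) \<in> arcs \<G> \<and>
      tail \<G> (case e of (a, b) \<Rightarrow> (g \<otimes> a, g \<otimes> b)) = g \<otimes> tail \<G> e \<and>
      head \<G> (case e of (a, b) \<Rightarrow> (g \<otimes> a, g \<otimes> b)) = g \<otimes> head \<G> e"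
    using e assms by (auto simp: cayley_graph_def)
qed (use assms in simp_all)

lemma graph_dist_eq_word_length:
  assumes "u \<in> carrier \<Gamma>" "v \<in> carrier \<Gamma>"
  shows "graph_dist \<G> u v = word_length (inv u \<otimes> v)"
proof -
  have "u \<otimes> (inv u \<otimes> v) = v"
    using assms by (simp add: m_assoc[symmetric])
  thus ?thesis
    using graph_dist_translate_le[of u v "inv u"] graph_dist_translate_le[of "\<one>" "inv u \<otimes> v" u] assms
    by (simp add: word_length_def)
qed

lemma word_length_nonneg: "word_length g \<ge> 0"
  unfolding word_length_def by (rule cayley.graph_dist_nonneg)

lemma word_length_pos: "g \<in> carrier \<Gamma> \<Longrightarrow> g \<noteq> \<one> \<Longrightarrow> word_length g > 0"
  unfolding word_length_def by (rule cayley.graph_dist_pos[OF reachable]) simp_all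

lemma word_length_mult:
  assumes "g \<in> carrier \<Gamma>" "h \<in> carrier \<Gamma>"
  shows "word_length (g \<otimes> h) \<le> word_length g + word_length h"
proof -
  have "word_length (g \<otimes> h) \<le> word_length g + graph_dist \<G> g (g \<otimes> h)"
    unfolding word_length_def by (rule cayley.graph_dist_triangle[OF reachable reachable]) (use assms in simp_all)
  thus ?thesis
    using assms by (simp add: graph_dist_eq_word_length m_assoc[symmetric])
qed

text \<open>Inversion is a graph automorphism because the group is abelian.\<close>

lemma word_length_inv:
  assumes "g \<in> carrier \<Gamma>"
  shows "word_length (inv g) = word_length g"
proof -
  have le: "word_length (inv x) \<le> word_length x" if "x \<in> carrier \<Gamma>" for x
  proof -
    have "graph_dist \<G> (inv \<one>) (inv x) \<le> graph_dist \<G> \<one> x"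
    proof (rule cayley.graph_dist_endomorphism[OF reachable, where f = "m_inv \<Gamma>" and F = "\<lambda>(a, b). (inv a, inv b)"])
      fix e assume "e \<in> arcs \<G>"
      then obtain a s where e: "e = (a, a \<otimes> s)" "a \<in> carrier \<Gamma>" "s \<in> S"
        by (auto simp: cayley_graph_def)
      have "inv (a \<otimes> s) = inv a \<otimes> inv s"
        using e gens by (auto simp: inv_mult)
      thus "(case e of (a, b) \<Rightarrow> (inv a, inv b)) \<in> arcs \<G> \<and>
          tail \<G> (case e of (a, b) \<Rightarrow> (inv a, inv b)) = inv (tail \<G> e) \<and>
          head \<G> (case e of (a, b) \<Rightarrow> (inv a, inv b)) = inv (head \<G> e)"
        using e inv_gens by (auto simp: cayley_graph_def)
    qed (use that in simp_all)
    thus ?thesis by (simp add: word_length_def)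
  qed
  show ?thesis
    using le[of g] le[of "inv g"] assms by simp
qed

text \<open>Translations act transitively on the vertices. Hence the transmission matrix is scalar,
  and the Laplacian is a function of the distance matrix alone.\<close>

lemma transmission_eq:
  assumes "u \<in> carrier \<Gamma>"
  shows "transmission \<G> u = (\<Sum>g\<in>carrier \<Gamma>. word_length g)"
proof -
  have "transmission \<G> u = (\<Sum>v\<in>carrier \<Gamma>. word_length (inv u \<otimes> v))"
    unfolding transmission_def verts_cayley_graph
    using assms by (intro sum.cong refl graph_dist_eq_word_length)
  also have "\<dots> = (\<Sum>g\<in>carrier \<Gamma>. word_length g)"
    by (rule sum.reindex_bij_witness[of _ "\<lambda>h. u \<otimes> h" "\<lambda>h. inv u \<otimes> h"])
       (use assms in \<open>auto simp: m_assoc[symmetric]\<close>)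
  finally show ?thesis .
qed

end

section \<open>Matrices with vanishing row and column sums\<close>

text \<open>For vanishing row sums this is the matrix of the map that \<open>A\<close> induces on
  the quotient by the constant vectors, in the basis of the classes of the unit vectors 1 to
  \<open>m\<close>.\<close>

definition deflation :: "nat \<Rightarrow> 'a :: ring_1 mat \<Rightarrow> 'a mat" where
  "deflation m A = mat m m (\<lambda>(i, j). A $$ (Suc i, Suc j) - A $$ (0, Suc j))"

text \<open>Conjugation by the base change that replaces the first unit vector by the all-ones vector.\<close>

lemma char_poly_deflation:
  fixes A :: "'a :: field mat"
  assumes A: "A \<in> carrier_mat (Suc m) (Suc m)"
    and rows: "\<And>i. i < Suc m \<Longrightarrow> (\<Sum>j<Suc m. A $$ (i, j)) = 0"
  shows "char_poly A = [:0, 1:] * char_poly (deflation m A)"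
proof -
  define P where "P = mat (Suc m) (Suc m) (\<lambda>(i, j). if j = 0 \<or> i = j then 1 else (0 :: 'a))"
  define Q where "Q = mat (Suc m) (Suc m) (\<lambda>(i, j). if i = j then 1 else if j = 0 then - 1 else (0 :: 'a))"
  define M where "M = four_block_mat (0\<^sub>m 1 1) (mat 1 m (\<lambda>(i, j). A $$ (0, Suc j))) (0\<^sub>m m 1) (deflation m A)"
  have P: "P \<in> carrier_mat (Suc m) (Suc m)" and Q: "Q \<in> carrier_mat (Suc m) (Suc m)"
    and M: "M \<in> carrier_mat (Suc m) (Suc m)"
    by (auto simp: P_def Q_def M_def deflation_def)
  have PQ: "P * Q = 1\<^sub>m (Suc m)"
  proof (rule eq_matI)
    fix i j assume "i < dim_row (1\<^sub>m (Suc m) :: 'a mat)" "j < dim_col (1\<^sub>m (Suc m) :: 'a mat)"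
    hence ij: "i < Suc m" "j < Suc m" by simp_all
    have "(P * Q) $$ (i, j) = (\<Sum>k<Suc m. P $$ (i, k) * Q $$ (k, j))"
      using ij P Q by (auto simp: scalar_prod_def atLeast0LessThan)
    also have "\<dots> = (\<Sum>k\<in>{0, i}. Q $$ (k, j))"
      using ij by (intro sum.mono_neutral_cong_right) (auto simp: P_def)
    also have "\<dots> = 1\<^sub>m (Suc m) $$ (i, j)"
      using ij by (cases "i = 0") (auto simp: Q_def)
    finally show "(P * Q) $$ (i, j) = 1\<^sub>m (Suc m) $$ (i, j)" .
  qed (use P Q in auto)
  have QP: "Q * P = 1\<^sub>m (Suc m)"
    by (rule mat_mult_left_right_inverse[OF P Q PQ])
  have Mi: "M $$ (i, j) = (if j = 0 then 0 else if i = 0 then A $$ (0, j) else A $$ (i, j) - A $$ (0, j))"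
    if "i < Suc m" "j < Suc m" for i j
    using that by (cases i; cases j) (auto simp: M_def deflation_def)
  \<comment> \<open>Column 0 of \<open>A * P\<close> consists of the row sums of \<open>A\<close>,
    which vanish, as does column 0 of \<open>M\<close>.\<close>
  have AP: "A * P = P * M"
  proof (rule eq_matI)
    fix i j assume "i < dim_row (P * M)" "j < dim_col (P * M)"
    hence ij: "i < Suc m" "j < Suc m" using P M by auto
    have "(A * P) $$ (i, j) = (\<Sum>k<Suc m. A $$ (i, k) * P $$ (k, j))"
      using ij A P by (auto simp: scalar_prod_def atLeast0LessThan)
    also have "\<dots> = (if j = 0 then 0 else A $$ (i, j))"
      using rows[OF ij(1)] ij by (auto simp: P_def if_distrib cong: if_cong)
    also have "\<dots> = (\<Sum>k<Suc m. P $$ (i, k) * M $$ (k, j))"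
    proof -
      have "(\<Sum>k<Suc m. P $$ (i, k) * M $$ (k, j)) = (\<Sum>k\<in>{0, i}. M $$ (k, j))"
        using ij by (intro sum.mono_neutral_cong_right) (auto simp: P_def)
      thus ?thesis using ij by (cases "i = 0") (auto simp: Mi)
    qed
    also have "\<dots> = (P * M) $$ (i, j)"
      using ij P M by (auto simp: scalar_prod_def atLeast0LessThan)
    finally show "(A * P) $$ (i, j) = (P * M) $$ (i, j)" .
  qed (use A P M in auto)
  have "A = A * (P * Q)"
    using A by (simp add: PQ)
  also have "\<dots> = P * M * Q"
    using A P Q by (simp add: AP flip: assoc_mult_mat[OF A P Q])
  finally have "similar_mat A M"
    unfolding similar_mat_def using similar_mat_witI[OF PQ QP _ A M P Q] by blast
  hence "char_poly A = char_poly M"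
    by (rule char_poly_similar)
  also have "\<dots> = char_poly (0\<^sub>m 1 1 :: 'a mat) * char_poly (deflation m A)"
    unfolding M_def by (rule char_poly_four_block_zeros_col) (auto simp: deflation_def)
  also have "char_poly (0\<^sub>m 1 1 :: 'a mat) = [:0, 1:]"
    by (simp add: char_poly_defs det_single)
  finally show ?thesis .
qed

text \<open>An eigenvector \<open>u\<close> of the quotient map, extended by 0, solves the equation
  for \<open>A\<close> up to a constant vector. Subtracting the mean \<open>a\<close> keeps the
  defect constant, and the vanishing column sums force it to be 0.\<close>

lemma eigenvector_of_deflation:
  fixes A :: "'a :: field_char_0 mat"
  assumes A: "A \<in> carrier_mat (Suc m) (Suc m)"
    and rows: "\<And>i. i < Suc m \<Longrightarrow> (\<Sum>j<Suc m. A $$ (i, j)) = 0"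
    and cols: "\<And>j. j < Suc m \<Longrightarrow> (\<Sum>i<Suc m. A $$ (i, j)) = 0"
    and root: "poly (char_poly (deflation m A)) x = 0"
  obtains f where "\<exists>i<Suc m. f i \<noteq> 0" "(\<Sum>i<Suc m. f i) = 0"
    "\<And>i. i < Suc m \<Longrightarrow> (\<Sum>j<Suc m. A $$ (i, j) * f j) = x * f i"
proof -
  have B: "deflation m A \<in> carrier_mat m m"
    by (simp add: deflation_def)
  from root obtain u where u: "u \<in> carrier_vec m" "u \<noteq> 0\<^sub>v m" "deflation m A *\<^sub>v u = x \<cdot>\<^sub>v u"
    using B unfolding eigenvalue_root_char_poly[OF B, symmetric] eigenvalue_def eigenvector_def by auto
  define v where "v j = (if j = 0 then 0 else u $ (j - 1))" for j
  define c where "c = (\<Sum>j<Suc m. A $$ (0, j) * v j)"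
  define a where "a = (\<Sum>i<Suc m. v i) / of_nat (Suc m)"
  define f where "f i = v i - a" for i
  have Av: "(\<Sum>j<Suc m. A $$ (i, j) * v j) = x * v i + c" if i: "i < Suc m" for i
  proof (cases i)
    case (Suc k)
    hence k: "k < m" using i by simp
    have "x * u $ k = (deflation m A *\<^sub>v u) $ k"
      using u k by simp
    also have "\<dots> = (\<Sum>j<m. (A $$ (Suc k, Suc j) - A $$ (0, Suc j)) * u $ j)"
      using k u(1) by (simp add: deflation_def scalar_prod_def atLeast0LessThan)
    also have "\<dots> = (\<Sum>j<Suc m. A $$ (i, j) * v j) - c"
      unfolding c_def by (subst (1 2) sum.lessThan_Suc_shift) (simp add: v_def Suc left_diff_distrib sum_subtractf)
    finally show ?thesis by (simp add: v_def Suc)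
  qed (simp add: v_def c_def)
  have sumf: "(\<Sum>i<Suc m. f i) = 0"
    by (simp add: f_def a_def sum_subtractf del: sum.lessThan_Suc of_nat_Suc)
  have Af: "(\<Sum>j<Suc m. A $$ (i, j) * f j) = x * f i + (x * a + c)" if i: "i < Suc m" for i
  proof -
    have "(\<Sum>j<Suc m. A $$ (i, j) * f j) = (\<Sum>j<Suc m. A $$ (i, j) * v j) - (\<Sum>j<Suc m. A $$ (i, j)) * a"
      by (simp only: f_def right_diff_distrib sum_subtractf sum_distrib_right)
    thus ?thesis
      using rows[OF i] Av[OF i] by (simp only:) (simp add: f_def algebra_simps)
  qed
  have "(\<Sum>i<Suc m. \<Sum>j<Suc m. A $$ (i, j) * f j) = 0"
    by (subst sum.swap) (simp add: sum_distrib_right[symmetric] cols del: sum.lessThan_Suc)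
  moreover have "(\<Sum>i<Suc m. \<Sum>j<Suc m. A $$ (i, j) * f j) = (\<Sum>i<Suc m. x * f i + (x * a + c))"
    by (intro sum.cong refl) (simp add: Af del: sum.lessThan_Suc)
  moreover have "\<dots> = x * (\<Sum>i<Suc m. f i) + of_nat (Suc m) * (x * a + c)"
    by (simp add: sum.distrib sum_distrib_left[symmetric] del: sum.lessThan_Suc of_nat_Suc)
  ultimately have "of_nat (Suc m) * (x * a + c) = 0"
    using sumf by simp
  hence c0: "x * a + c = 0"
    by (metis mult_eq_0_iff of_nat_eq_0_iff nat.distinct(1))
  \<comment> \<open>If \<open>f\<close> vanished, \<open>v\<close> would be constant; since
    \<open>v 0 = 0\<close>, this would make \<open>u\<close> zero.\<close>
  have "\<exists>i<Suc m. f i \<noteq> 0"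
  proof (rule ccontr)
    assume "\<not> ?thesis"
    hence eq: "v i = a" if "i < Suc m" for i using that by (auto simp: f_def)
    have "a = 0" using eq[of 0] by (simp add: v_def)
    hence "u $ k = 0" if "k < m" for k using eq[of "Suc k"] that by (simp add: v_def)
    with u(1,2) show False by (auto intro: eq_vecI)
  qed
  with sumf Af c0 that show ?thesis by simp
qed

text \<open>The constants account for one eigenvalue 0, the sum-zero vectors for the others.
  \<open>ev\<close> treats complex eigenvectors and delivers reality, which turns complex roots into
  roots of the real characteristic polynomial.\<close>

lemma spectral_gap_ge:
  fixes A :: "real mat"
  assumes A: "A \<in> carrier_mat n n" and n: "n \<ge> 2"
    and rows: "\<And>i. i < n \<Longrightarrow> (\<Sum>j<n. A $$ (i, j)) = 0"
    and cols: "\<And>j. j < n \<Longrightarrow> (\<Sum>i<n. A $$ (i, j)) = 0"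
    and ev: "\<And>x f. \<exists>i<n. f i \<noteq> 0 \<Longrightarrow> (\<Sum>i<n. f i) = 0 \<Longrightarrow>
      (\<And>i. i < n \<Longrightarrow> (\<Sum>j<n. complex_of_real (A $$ (i, j)) * f j) = x * f i) \<Longrightarrow> x \<in> \<real> \<and> \<kappa> \<le> Re x"
    and \<kappa>: "\<kappa> \<ge> 0"
  shows "spectral_gap A \<ge> \<kappa>"
proof -
  obtain m where m: "n = Suc m" "m > 0"
    using n by (cases n) auto
  define B where "B = deflation m A"
  define AC where "AC = map_mat complex_of_real A"
  have B: "B \<in> carrier_mat m m"
    by (simp add: B_def deflation_def)
  have AC: "AC \<in> carrier_mat n n" and ACi: "\<And>i j. i < n \<Longrightarrow> j < n \<Longrightarrow> AC $$ (i, j) = of_real (A $$ (i, j))"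
    using A by (auto simp: AC_def)
  have BC: "deflation m AC = map_mat complex_of_real B"
    using A by (intro eq_matI) (auto simp: AC_def B_def deflation_def m)
  have cpC: "char_poly (deflation m AC) = map_poly complex_of_real (char_poly B)"
    unfolding BC by (rule of_real_hom.char_poly_hom[OF B])
  have ACrows: "(\<Sum>j<n. AC $$ (i, j)) = 0" if "i < n" for i
    using rows[OF that] that by (simp add: ACi flip: of_real_sum)
  have ACcols: "(\<Sum>i<n. AC $$ (i, j)) = 0" if "j < n" for j
    using cols[OF that] that by (simp add: ACi flip: of_real_sum)
  have roots: "x \<in> \<real> \<and> \<kappa> \<le> Re x" if root: "poly (char_poly (deflation m AC)) x = 0" for x
  proof -
    obtain f where f: "\<exists>i<n. f i \<noteq> 0" "(\<Sum>i<n. f i) = 0"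
      "\<And>i. i < n \<Longrightarrow> (\<Sum>j<n. AC $$ (i, j) * f j) = x * f i"
      using eigenvector_of_deflation[OF AC[unfolded m(1)] ACrows[unfolded m(1)] ACcols[unfolded m(1)] root]
      unfolding m(1) by metis
    have "(\<Sum>j<n. complex_of_real (A $$ (i, j)) * f j) = x * f i" if "i < n" for i
      using f(3)[OF that] that by (simp add: ACi)
    thus ?thesis using ev[OF f(1,2)] by blast
  qed
  have cpB: "char_poly B \<noteq> 0" "degree (char_poly B) = m"
    using degree_monic_char_poly[OF B] m by auto
  \<comment> \<open>A root beyond the split-off 0 must exist for position 1 of the sorted list to be
    meaningful.\<close>
  have "\<exists>x. poly (char_poly (deflation m AC)) x = 0"
    by (rule fundamental_theorem_of_algebra) (use cpB m in \<open>simp add: constant_degree cpC\<close>)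
  then obtain x where x: "poly (char_poly (deflation m AC)) x = 0" by blast
  from roots[OF x] obtain r where "x = of_real r" by (auto elim: Reals_cases)
  with x have "poly (char_poly B) r = 0"
    by (simp add: cpC)
  hence ne: "proots (char_poly B) \<noteq> {#}"
    using cpB by (auto simp flip: set_mset_eq_empty_iff)
  have ge: "\<kappa> \<le> r" if "r \<in># proots (char_poly B)" for r
    using that roots[of "of_real r"] cpB by (simp add: cpC)
  have "char_poly A = [:0, 1:] * char_poly B"
    unfolding B_def using char_poly_deflation[of A m] A rows m by simp
  also have "proots \<dots> = proots [:0, 1:] + proots (char_poly B)"
    using cpB(1) by (intro proots_mult) auto
  also have "proots [:0, 1 :: real:] = {#0#}"
    using proots_linear_factor[of "0 :: real"] by simp
  finally have "proots (char_poly A) = {#0#} + proots (char_poly B)" .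
  hence "sorted_eigenvalues A = insort 0 (sorted_list_of_multiset (proots (char_poly B)))"
    by (simp add: sorted_eigenvalues_def)
  moreover obtain y ys where y: "sorted_list_of_multiset (proots (char_poly B)) = y # ys"
    using ne by (metis list.exhaust mset_sorted_list_of_multiset mset.simps(1))
  have "y \<in># proots (char_poly B)"
    using y by (metis mset_sorted_list_of_multiset list.set_intros(1) set_mset_mset)
  hence "\<kappa> \<le> y" by (rule ge)
  \<comment> \<open>From \<open>0 \<le> \<kappa> \<le> y\<close>, \<open>insort\<close> puts 0 at
    the front and \<open>y\<close> lands at position 1.\<close>
  ultimately show ?thesis
    using y \<kappa> by (simp add: spectral_gap_def)
qed

section \<open>The spectral gap\<close>

text \<open>With \<open>v = u \<otimes> k\<close> the distance matrix acts as a convolution with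
  \<open>word_length\<close>, so \<open>x\<close> is a character sum.\<close>

lemma (in connected_cayley_graph) distance_eigenvalue:
  fixes f :: "'a \<Rightarrow> complex"
  assumes f: "\<exists>g\<in>carrier \<Gamma>. f g \<noteq> 0" "(\<Sum>g\<in>carrier \<Gamma>. f g) = 0"
    and eig: "\<And>u. u \<in> carrier \<Gamma> \<Longrightarrow> (\<Sum>v\<in>carrier \<Gamma>. graph_dist \<G> u v * f v) = x * f u"
  defines "t \<equiv> (\<Sum>g\<in>carrier \<Gamma>. word_length g)"
  shows "x \<in> \<real>" "3 * Re x \<le> t" "odd (card (carrier \<Gamma>)) \<Longrightarrow> (5 + 4 * sqrt 2) * Re x \<le> 3 * t"
proof -
  have eig': "(\<Sum>k\<in>carrier \<Gamma>. of_real (word_length k) * f (u \<otimes> k)) = x * f u" if u: "u \<in> carrier \<Gamma>" for u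
  proof -
    have "(\<Sum>k\<in>carrier \<Gamma>. of_real (word_length k) * f (u \<otimes> k))
        = (\<Sum>v\<in>carrier \<Gamma>. graph_dist \<G> u v * f v)"
      by (rule sum.reindex_bij_witness[of _ "\<lambda>v. inv u \<otimes> v" "\<lambda>k. u \<otimes> k"])
         (use u in \<open>auto simp: m_assoc[symmetric] graph_dist_eq_word_length\<close>)
    with eig[OF u] show ?thesis by simp
  qed
  obtain \<chi> where "finite_abelian_character \<Gamma> \<chi>"
    and x: "x = (\<Sum>k\<in>carrier \<Gamma>. of_real (word_length k) * \<chi> k)"
    using convolution_eigenvalue_character[OF finite_group f eig'] by blast
  then interpret finite_abelian_character \<Gamma> \<chi> by simp
  \<comment> \<open>Conjugation replaces \<open>\<chi> k\<close> by \<open>\<chi> (inv k)\<close>;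
    as lengths are invariant under inversion, it only reindexes the sum.\<close>
  have "cnj x = (\<Sum>k\<in>carrier \<Gamma>. of_real (word_length (inv k)) * \<chi> (inv k))"
    by (simp add: x char_inv word_length_inv)
  also have "\<dots> = x"
    unfolding x by (rule sum_inv)
  finally show "x \<in> \<real>"
    by (simp add: Reals_cnj_iff)
  have Re: "Re x = (\<Sum>g\<in>carrier \<Gamma>. word_length g * Re (\<chi> g))"
    by (simp add: x)
  have t: "t \<ge> 0"
    unfolding t_def by (intro sum_nonneg word_length_nonneg)
  have bound: "(5 + 4 * sqrt 2) * Re x \<le> 3 * t" if "(\<Sum>g\<in>carrier \<Gamma>. (\<chi> g)\<^sup>2) = 0"
    unfolding Re t_def by (rule length_char_bound[OF word_length_mult that])
  thus "odd (card (carrier \<Gamma>)) \<Longrightarrow> (5 + 4 * sqrt 2) * Re x \<le> 3 * t"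
    using sum_char_sq_odd by blast
  show "3 * Re x \<le> t"
    using sum_char_sq_cases
  proof
    assume "\<forall>g\<in>carrier \<Gamma>. (\<chi> g)\<^sup>2 = 1"
    from length_char_bound_real[OF word_length_mult this] show ?thesis
      by (simp add: Re t_def)
  next
    assume "(\<Sum>g\<in>carrier \<Gamma>. (\<chi> g)\<^sup>2) = 0"
    hence b: "(5 + 4 * sqrt 2) * Re x \<le> 3 * t" by (rule bound)
    show ?thesis
    proof (cases "Re x \<le> 0")
      case False
      \<comment> \<open>For positive \<open>Re x\<close>, \<open>sqrt 2 \<ge> 1\<close> makes the
        second bound imply \<open>9 * Re x \<le> 3 * t\<close>.\<close>
      have "9 * Re x \<le> (5 + 4 * sqrt 2) * Re x"
        using False by (intro mult_right_mono) auto
      with b show ?thesis by linarith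
    qed (use t in linarith)
  qed
qed

theorem theorem1p4:
  fixes \<Gamma> :: "('a, 'm) monoid_scheme" and S :: "'a set" and vs :: "'a list"
  assumes "comm_group \<Gamma>"
    and "finite (carrier \<Gamma>)"
    and "card (carrier \<Gamma>) \<ge> 2"
    and "S \<subseteq> carrier \<Gamma>"
    and "\<And>s. s \<in> S \<Longrightarrow> inv\<^bsub>\<Gamma>\<^esub> s \<in> S"
    and "connected (cayley_graph \<Gamma> S)"
    and "distinct vs" and "set vs = verts (cayley_graph \<Gamma> S)"
  shows "spectral_gap (normalized_distance_laplacian (cayley_graph \<Gamma> S) vs) \<ge> 2 / 3 \<and>
    (odd (card (carrier \<Gamma>)) \<longrightarrow>
       spectral_gap (normalized_distance_laplacian (cayley_graph \<Gamma> S) vs) > 0.718)"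
proof -
  interpret connected_cayley_graph \<Gamma> S
    by (intro connected_cayley_graph.intro connected_cayley_graph_axioms.intro assms)
  define n where "n = length vs"
  define t where "t = (\<Sum>g\<in>carrier \<Gamma>. word_length g)"
  define A where "A = normalized_distance_laplacian \<G> vs"
  have vs: "set vs = carrier \<Gamma>" using assms by simp
  have n: "n = card (carrier \<Gamma>)"
    using assms(7) vs unfolding n_def by (metis distinct_card)
  have bij: "bij_betw (nth vs) {..<n} (carrier \<Gamma>)"
    using bij_betw_nth[OF assms(7)] vs by (simp add: n_def)
  have vsi: "vs ! i \<in> carrier \<Gamma>" if "i < n" for i
    using that vs nth_mem[of i vs] by (simp add: n_def)
  \<comment> \<open>A group of order at least 2 has an element of positive length; this permits
    division by \<open>t\<close>.\<close>
  have tpos: "t > 0"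
  proof -
    obtain g where "g \<in> carrier \<Gamma>" "g \<noteq> \<one>\<^bsub>\<Gamma>\<^esub>"
      using assms(3) by (metis card_le_Suc0_iff_eq finite_group not_less_eq_eq numeral_2_eq_2)
    thus ?thesis unfolding t_def
      by (intro sum_pos2[OF finite_group]) (auto intro: word_length_pos word_length_nonneg)
  qed
  have A: "A \<in> carrier_mat n n"
    by (rule carrier_matI)
       (simp_all add: A_def normalized_distance_laplacian_def transmission_matrix_inv_sqrt_def n_def mat_diag_def)
  have Ai: "A $$ (i, j) = (if i = j then 1 else 0) - graph_dist \<G> (vs ! i) (vs ! j) / t"
    if ij: "i < n" "j < n" for i j
  proof -
    have "t powr (- 1 / 2) * t powr (- 1 / 2) = 1 / t"
      using tpos by (simp add: powr_minus_divide flip: powr_add)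
    hence *: "t powr (- 1 / 2) * y * t powr (- 1 / 2) = y / t" for y
      by (metis mult.assoc mult.commute mult.right_neutral times_divide_eq_right)
    have diag: "(mat_diag n p * M * mat_diag n p) $$ (i, j) = p i * M $$ (i, j) * p j"
      if M: "M \<in> carrier_mat n n" for p :: "nat \<Rightarrow> real" and M
      using ij by (simp add: mat_diag_mult_left[OF M] mat_diag_mult_right[of _ n n])
    define M where "M = transmission_matrix \<G> vs - distance_matrix \<G> vs"
    have M: "M \<in> carrier_mat n n"
      by (rule carrier_matI) (simp_all add: M_def distance_matrix_def n_def)
    have "M $$ (i, j) = (if i = j then t else 0) - graph_dist \<G> (vs ! i) (vs ! j)"
      using ij by (simp add: M_def transmission_matrix_def distance_matrix_def transmission_eq vsi t_def
          mat_diag_def flip: n_def)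
    hence "A $$ (i, j)
        = t powr (- 1 / 2) * ((if i = j then t else 0) - graph_dist \<G> (vs ! i) (vs ! j)) * t powr (- 1 / 2)"
      unfolding A_def normalized_distance_laplacian_def transmission_matrix_inv_sqrt_def
        n_def[symmetric] M_def[symmetric] diag[OF M]
      using ij by (simp add: transmission_eq vsi t_def)
    thus ?thesis
      unfolding * using tpos by (simp add: diff_divide_distrib)
  qed
  have dist_sym: "graph_dist \<G> u v = graph_dist \<G> v u" if "u \<in> carrier \<Gamma>" "v \<in> carrier \<Gamma>" for u v
    using word_length_inv[of "inv\<^bsub>\<Gamma>\<^esub> u \<otimes>\<^bsub>\<Gamma>\<^esub> v"] that
    by (simp add: graph_dist_eq_word_length inv_mult_group)
  have rows: "(\<Sum>j<n. A $$ (i, j)) = 0" if i: "i < n" for i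
  proof -
    have "(\<Sum>j<n. A $$ (i, j)) = (\<Sum>j<n. (if i = j then 1 else 0)) - (\<Sum>j<n. graph_dist \<G> (vs ! i) (vs ! j)) / t"
      using i by (simp add: Ai sum_subtractf sum_divide_distrib)
    also have "(\<Sum>j<n. graph_dist \<G> (vs ! i) (vs ! j)) = transmission \<G> (vs ! i)"
      using sum.reindex_bij_betw[OF bij, of "\<lambda>v. graph_dist \<G> (vs ! i) v"] by (simp add: transmission_def)
    also have "\<dots> = t"
      using vsi[OF i] by (simp add: transmission_eq t_def)
    finally show ?thesis using i tpos by simp
  qed
  have sym: "A $$ (i, j) = A $$ (j, i)" if "i < n" "j < n" for i j
    using that by (simp add: Ai dist_sym vsi)
  have cols: "(\<Sum>i<n. A $$ (i, j)) = 0" if "j < n" for j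
    using rows[OF that] that by (simp add: sym[of _ j])
  have eigen: "x \<in> \<real> \<and> 2 / 3 \<le> Re x \<and> (odd (card (carrier \<Gamma>)) \<longrightarrow> 1 - 3 / (5 + 4 * sqrt 2) \<le> Re x)"
    if f: "\<exists>i<n. f i \<noteq> 0" "(\<Sum>i<n. f i) = 0"
      and eig: "\<And>i. i < n \<Longrightarrow> (\<Sum>j<n. complex_of_real (A $$ (i, j)) * f j) = x * f i" for x f
  proof -
    define F where "F v = f (the_inv_into {..<n} (nth vs) v)" for v
    have Fi: "F (vs ! i) = f i" if "i < n" for i
      using the_inv_into_f_f[OF bij_betw_imp_inj_on[OF bij]] that by (simp add: F_def)
    \<comment> \<open>By \<open>Ai\<close>, \<open>A\<close> is the identity minus the distance
      matrix divided by \<open>t\<close>, so \<open>y\<close> is the distance eigenvalue belonging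
      to \<open>x\<close>.\<close>
    define y where "y = of_real t * (1 - x)"
    have F0: "\<exists>g\<in>carrier \<Gamma>. F g \<noteq> 0"
      using f(1) Fi vsi by metis
    have Fsum: "(\<Sum>g\<in>carrier \<Gamma>. F g) = 0"
      using sum.reindex_bij_betw[OF bij, of F] f(2) by (simp add: Fi)
    have Feig: "(\<Sum>v\<in>carrier \<Gamma>. graph_dist \<G> u v * F v) = y * F u" if "u \<in> carrier \<Gamma>" for u
    proof -
      obtain i where i: "i < n" "u = vs ! i"
        using \<open>u \<in> carrier \<Gamma>\<close> vs by (metis in_set_conv_nth n_def)
      have "x * f i = (\<Sum>j<n. (if i = j then f j else 0) - of_real (graph_dist \<G> u (vs ! j)) * f j / of_real t)"
        unfolding eig[OF i(1), symmetric] by (intro sum.cong refl) (auto simp: Ai i left_diff_distrib)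
      also have "\<dots> = f i - (\<Sum>j<n. of_real (graph_dist \<G> u (vs ! j)) * f j) / of_real t"
        using i by (simp add: sum_subtractf sum_divide_distrib)
      finally have "(\<Sum>j<n. of_real (graph_dist \<G> u (vs ! j)) * f j) = y * f i"
        using tpos by (simp add: y_def field_simps)
      thus ?thesis
        using sum.reindex_bij_betw[OF bij, of "\<lambda>v. of_real (graph_dist \<G> u v) * F v"] i by (simp add: Fi)
    qed
    have b: "y \<in> \<real>" "3 * Re y \<le> t" "odd (card (carrier \<Gamma>)) \<Longrightarrow> (5 + 4 * sqrt 2) * Re y \<le> 3 * t"
      using distance_eigenvalue[OF F0 Fsum Feig] by (simp_all add: t_def)
    have x: "x = 1 - y / of_real t" and Rex: "Re x = 1 - Re y / t"
      using tpos by (auto simp: y_def field_simps)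
    have "x \<in> \<real>" unfolding x using b(1) by auto
    moreover have "2 / 3 \<le> Re x"
      unfolding Rex using b(2) tpos by (simp add: field_simps)
    moreover have "1 - 3 / (5 + 4 * sqrt 2) \<le> Re x" if "odd (card (carrier \<Gamma>))"
    proof -
      have "5 + 4 * sqrt 2 > 0" by (simp add: add_pos_nonneg)
      hence "Re y / t \<le> 3 / (5 + 4 * sqrt 2)"
        using b(3)[OF that] tpos by (simp add: divide_le_eq pos_le_divide_eq mult.commute)
      thus ?thesis unfolding Rex by simp
    qed
    ultimately show ?thesis by blast
  qed
  \<comment> \<open>This precision suffices: \<open>5 + 4 * sqrt 2 > 10.656\<close> and
    \<open>3 / 10.656 < 0.282\<close>.\<close>
  have "sqrt 2 > 1.414"
    by (rule real_less_rsqrt) (simp add: power2_eq_square)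
  hence c: "1 - 3 / (5 + 4 * sqrt 2) > (0.718 :: real)"
    by (simp add: field_simps)
  have "n \<ge> 2" using assms(3) n by simp
  note gap = spectral_gap_ge[OF A this rows cols]
  have "spectral_gap A \<ge> 2 / 3"
    by (rule gap) (use eigen in auto)
  moreover have "spectral_gap A > 0.718" if "odd (card (carrier \<Gamma>))"
  proof -
    have "spectral_gap A \<ge> 1 - 3 / (5 + 4 * sqrt 2)"
      by (rule gap) (use eigen that c in auto)
    with c show ?thesis by linarith
  qed
  ultimately show ?thesis unfolding A_def by blast
qed

end
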